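(* Let $f:\mathbb{A}\to\mathbb{A}$ be a symplectic homeomorphism that preserves each leaf of a $C^0$-foliation $\mathcal{F}$ of $\mathbb{A}$. If the foliation is symplectically straightenable by a symplectic homeomorphism $\Phi:\mathbb{A}\to\mathbb{A}$ that maps the standard foliation $\mathcal{F}_0$ to $\mathcal{F}=\Phi(\mathcal{F}_0)$, then $\Phi$ provides $C^0$ Arnol'd-Liouville coordinates for $f$; that is, the standard foliation is invariant by $\Phi^{-1}\circ f\circ\Phi$ and there is a continuous function $\rho:\mathbb{R}\to\mathbb{R}$ such that $\Phi^{-1}\circ f\circ\Phi(x,c)=(x+\rho(c),c)$ for all $(x,c)\in\mathbb{A}$.
   Context: $\mathbb{T}=\mathbb{R}/\mathbb{Z}$, $\mathbb{A}=\mathbb{T}\times\mathbb{R}$ with symplectic form $-d(r\,d\theta)$. The standard foliation $\mathcal{F}_0$ has leaves $\mathbb{T}\times\{c\}$, $c\in\mathbb{R}$. A foliation is preserved (invariant) by a map if every leaf is mapped onto itself. A symplectic homeomorphism (in the sense of Oh and Müller) is a homeomorphism that is a limit, for the $C^0$ compact-open topology, of a sequence of symplectic diffeomorphisms; in this 2-dimensional setting this coincides with the notion of orientation and Lebesgue measure preserving homeomorphism. $C^0$ Arnol'd-Liouville coordinates for a symplectic homeomorphism $f$ of $\mathbb{A}$ are given by a symplectic homeomorphism $\Phi:\mathbb{A}\to\mathbb{A}$ such that the standard foliation is invariant by $\Phi^{-1}\circ f\circ\Phi$ and $\Phi^{-1}\circ f\circ\Phi(x,c)=(x+\rho(c),c)$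 for some continuous $\rho:\mathbb{R}\to\mathbb{R}$. *)

theory Defs
  imports "HOL-Analysis.Analysis"
begin

section \<open>The annulus\<close>

quotient_type circle = real / "\<lambda>x y :: real. x - y \<in> \<int>"
  morphisms rep_circle circle_of
proof (rule equivpI)
  show "reflp (\<lambda>x y :: real. x - y \<in> \<int>)"
    by (simp add: reflp_def)
  show "symp (\<lambda>x y :: real. x - y \<in> \<int>)"
    by (metis (no_types, lifting) Ints_minus minus_diff_eq sympI)
  show "transp (\<lambda>x y :: real. x - y \<in> \<int>)"
  proof (rule transpI)
    fix x y z :: real
    assume "x - y \<in> \<int>" "y - z \<in> \<int>"
    then have "(x - y) + (y - z) \<in> \<int>" by (rule Ints_add)
    then show "x - z \<in> \<int>" by simp
  qed
qed

instantiation circle :: ab_group_add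
begin

lift_definition zero_circle :: circle is "0 :: real" .

lift_definition plus_circle :: "circle \<Rightarrow> circle \<Rightarrow> circle" is "(+) :: real \<Rightarrow> real \<Rightarrow> real"
  by (metis Ints_add add_diff_add)

lift_definition uminus_circle :: "circle \<Rightarrow> circle" is "uminus :: real \<Rightarrow> real"
  by (metis Ints_minus minus_diff_minus)

lift_definition minus_circle :: "circle \<Rightarrow> circle \<Rightarrow> circle" is "(-) :: real \<Rightarrow> real \<Rightarrow> real"
proof -
  fix a b c d :: real
  assume "a - b \<in> \<int>" "c - d \<in> \<int>"
  then have "(a - b) - (c - d) \<in> \<int>" by (rule Ints_diff)
  then show "(a - c) - (b - d) \<in> \<int>" by (simp add: algebra_simps)
qed

instance
  by standard (transfer; simp)+

end

text \<open>Quotient topology. The annulus then carries the product topology.\<close>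

instantiation circle :: topological_space
begin

definition open_circle :: "circle set \<Rightarrow> bool" where
  "open_circle U \<longleftrightarrow> open (circle_of -` U)"

instance
proof
  show "open (UNIV :: circle set)"
    by (simp add: open_circle_def)
  show "open (S \<inter> T)" if "open S" "open T" for S T :: "circle set"
    using that by (auto simp: open_circle_def vimage_Int)
  show "open (\<Union>K)" if "\<forall>S\<in>K. open S" for K :: "circle set set"
    using that by (auto simp: open_circle_def vimage_Union)
qed

end

type_synonym plane = "real \<times> real"
type_synonym annulus = "circle \<times> real"

definition annulus_of :: "plane \<Rightarrow> annulus" where
  "annulus_of z = (circle_of (fst z), snd z)"


section \<open>Symplectic diffeomorphisms and homeomorphisms\<close>

primrec C_k :: "nat \<Rightarrow> ('a::euclidean_space \<Rightarrow> 'b::euclidean_space) \<Rightarrow> bool" where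
  "C_k 0 f \<longleftrightarrow> continuous_on UNIV f"
| "C_k (Suc k) f \<longleftrightarrow>
     (\<forall>x. f differentiable (at x)) \<and> (\<forall>v. C_k k (\<lambda>x. frechet_derivative f (at x) v))"

definition smooth :: "('a::euclidean_space \<Rightarrow> 'b::euclidean_space) \<Rightarrow> bool" where
  "smooth f \<longleftrightarrow> (\<forall>k. C_k k f)"

definition is_lift :: "(plane \<Rightarrow> plane) \<Rightarrow> (annulus \<Rightarrow> annulus) \<Rightarrow> bool" where
  "is_lift H h \<longleftrightarrow> (\<forall>z. annulus_of (H z) = h (annulus_of z))"

text \<open>The smooth structure of the annulus is the one making the universal covering
  \<^const>\<open>annulus_of\<close> a local diffeomorphism. As the plane is simply connected, every continuous
  self-map of the annulus has a lift, unique up to integer translations of the first coordinate,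
  and the map is smooth iff its lifts are. Its derivative, read in the coordinates
  \<open>(\<theta>, r)\<close>, is that of any lift.\<close>

definition smooth_map :: "(annulus \<Rightarrow> annulus) \<Rightarrow> bool" where
  "smooth_map h \<longleftrightarrow> (\<exists>H. is_lift H h \<and> smooth H)"

text \<open>The symplectic form \<open>- d(r d\<theta>) = d\<theta> \<and> dr\<close>, with
  constant coefficients in the coordinates \<open>(\<theta>, r)\<close>.\<close>

definition symplectic_form :: "plane \<Rightarrow> plane \<Rightarrow> real" where
  "symplectic_form u v = fst u * snd v - snd u * fst v"

definition symplectic_diffeomorphism :: "(annulus \<Rightarrow> annulus) \<Rightarrow> bool" where
  "symplectic_diffeomorphism h \<longleftrightarrow>
     bij h \<and> smooth_map (inv h) \<and>
     (\<exists>H. is_lift H h \<and> smooth H \<and>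
       (\<forall>z u v. symplectic_form (frechet_derivative H (at z) u) (frechet_derivative H (at z) v)
                = symplectic_form u v))"

definition compact_open_topology ::
    "('a::topological_space \<Rightarrow> 'b::topological_space) topology" where
  "compact_open_topology = topology_generated_by
     {{h. continuous_on UNIV h \<and> h ` K \<subseteq> U} | K U. compact K \<and> open U}"

definition symplectic_homeomorphism :: "(annulus \<Rightarrow> annulus) \<Rightarrow> bool" where
  "symplectic_homeomorphism f \<longleftrightarrow>
     (\<exists>g. homeomorphism UNIV UNIV f g) \<and>
     (\<exists>h :: nat \<Rightarrow> annulus \<Rightarrow> annulus. (\<forall>n. symplectic_diffeomorphism (h n)) \<and>
        limitin compact_open_topology h f sequentially)"


section \<open>Foliations\<close>

text \<open>A one-dimensional foliation of a surface is a partition into leaves such that every point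
  has a chart \<open>\<phi>\<close> onto the plane in which the plaques, i.e. the path components of the
  traces of the leaves, are exactly the horizontal lines. A leaf may return to the chart through
  several plaques.\<close>

definition C0_foliation :: "annulus set set \<Rightarrow> bool" where
  "C0_foliation F \<longleftrightarrow>
     partition_on UNIV F \<and>
     (\<forall>L\<in>F. path_connected L) \<and>
     (\<forall>p. \<exists>U (\<phi> :: annulus \<Rightarrow> plane) \<psi>. open U \<and> p \<in> U \<and> homeomorphism U UNIV \<phi> \<psi> \<and>
        (\<forall>L\<in>F. \<forall>q \<in> L \<inter> U. path_component_set (L \<inter> U) q = {q' \<in> U. snd (\<phi> q') = snd (\<phi> q)}))"

definition standard_foliation :: "annulus set set" where
  "standard_foliation = {UNIV \<times> {c} | c. True}"

definition preserves_leaves :: "(annulus \<Rightarrow> annulus) \<Rightarrow> annulus set set \<Rightarrow> bool" where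
  "preserves_leaves f F \<longleftrightarrow> (\<forall>L\<in>F. f ` L = L)"

definition symplectically_straightens :: "(annulus \<Rightarrow> annulus) \<Rightarrow> annulus set set \<Rightarrow> bool" where
  "symplectically_straightens \<Phi> F \<longleftrightarrow>
     symplectic_homeomorphism \<Phi> \<and> F = (\<lambda>L. \<Phi> ` L) ` standard_foliation"

definition C0_Arnold_Liouville_coordinates ::
    "(annulus \<Rightarrow> annulus) \<Rightarrow> (annulus \<Rightarrow> annulus) \<Rightarrow> bool" where
  "C0_Arnold_Liouville_coordinates \<Phi> f \<longleftrightarrow>
     symplectic_homeomorphism \<Phi> \<and>
     preserves_leaves (inv \<Phi> \<circ> f \<circ> \<Phi>) standard_foliation \<and>
     (\<exists>\<rho> :: real \<Rightarrow> real. continuous_on UNIV \<rho> \<and>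
        (\<forall>x c. (inv \<Phi> \<circ> f \<circ> \<Phi>) (x, c) = (x + circle_of (\<rho> c), c)))"

end

theory Submission
  imports Defs "HOL-Complex_Analysis.Winding_Numbers"
begin

text \<open>
  Write \<open>g = \<Phi>\<inverse> \<circ> f \<circ> \<Phi>\<close>. Since \<open>f\<close> maps every leaf \<open>\<Phi>(\<T> \<times> {c})\<close> onto itself,
  \<open>g\<close> maps every circle \<open>\<T> \<times> {c}\<close> onto itself, and what has to be shown is that it rotates
  each of them. Two facts force this. A map that preserves area and all the circles
  preserves length on each circle, because thin rectangles around an arc go to thin strips around
  its image; and a map that preserves orientation and each circle, hence the order of the
  circles, cannot reverse any of them.

  Both facts are read off in the universal cover. A lift of a symplectic homeomorphism is a
  homeomorphism of the plane that is a locally uniform limit of symplectic diffeomorphisms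
  (\<open>symplectic_homeomorphism_lift\<close>); such maps are called \<open>C0_symplectic\<close> below. They form a
  group: closure under composition is uniform continuity, and closure under inversion rests on
  Brouwer's theorem, by which an approximation \<open>H\<close> of \<open>G\<close> takes the value \<open>y\<close> at a
  point near \<open>G\<inverse> y\<close> (\<open>C0_symplectic_inv\<close>). Hence the lift \<open>G\<close> of \<open>g\<close>, a composition of lifts of
  \<open>\<Phi>\<close> and \<open>f\<close> and of an inverse, is itself such a limit, and no property has to be
  transported through \<open>\<Phi>\<close>.

  For orientation, the image under \<open>G\<close> of a circle in the plane winds once around the image of its
  centre, since this holds for symplectic diffeomorphisms and winding numbers are stable
  under uniform approximation; if \<open>G\<close> were decreasing on a horizontal line, that image
  would be homotopic to a reflected circle, with winding number \<open>-1\<close>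
  (\<open>C0_symplectic_fibre_increasing\<close>).

  For area, if \<open>G\<close> contracted a horizontal segment, a thin rectangle around it would be
  sent by \<open>G\<close>, hence by an approximating symplectic diffeomorphism, into a rectangle of
  smaller area (\<open>C0_symplectic_fibre_expanding\<close>). So \<open>G\<close> contracts no segment,
  neither does \<open>G\<inverse>\<close>, and \<open>G\<close> is an increasing isometry, that is a translation, on each
  horizontal line.
\<close>

section \<open>Symplectic diffeomorphisms of the plane\<close>

text \<open>
  Stated with first derivatives, which determine area and local winding numbers; with the
  differentiability of the inverse included, these maps visibly form a group.
\<close>

definition plane_symplectomorphism :: "(plane \<Rightarrow> plane) \<Rightarrow> bool" where
  "plane_symplectomorphism H \<longleftrightarrow>
     bij H \<and> (\<forall>z. inv H differentiable (at z)) \<and>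
     (\<forall>z. \<exists>D. (H has_derivative D) (at z) \<and>
        (\<forall>u v. symplectic_form (D u) (D v) = symplectic_form u v))"

lemma plane_symplectomorphism_continuous:
  "plane_symplectomorphism H \<Longrightarrow> continuous_on S H"
  unfolding plane_symplectomorphism_def
  by (meson continuous_at_imp_continuous_on has_derivative_continuous)

lemma plane_symplectomorphism_comp:
  assumes "plane_symplectomorphism H" "plane_symplectomorphism K"
  shows "plane_symplectomorphism (H \<circ> K)"
proof -
  have bij: "bij H" "bij K" using assms unfolding plane_symplectomorphism_def by auto
  have "inv (H \<circ> K) differentiable (at z)" for z
    unfolding o_inv_distrib[OF bij]
    by (rule differentiable_chain_at)
      (use assms in \<open>simp_all only: plane_symplectomorphism_def\<close>)
  moreover have "\<exists>D. (H \<circ> K has_derivative D) (at z) \<and>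
        (\<forall>u v. symplectic_form (D u) (D v) = symplectic_form u v)" for z
  proof -
    obtain DH where DH: "(H has_derivative DH) (at (K z))"
        "\<forall>u v. symplectic_form (DH u) (DH v) = symplectic_form u v"
      using assms(1) unfolding plane_symplectomorphism_def by blast
    obtain DK where DK: "(K has_derivative DK) (at z)"
        "\<forall>u v. symplectic_form (DK u) (DK v) = symplectic_form u v"
      using assms(2) unfolding plane_symplectomorphism_def by blast
    show ?thesis
      using diff_chain_at[OF DK(1) DH(1)] DH(2) DK(2) by (intro exI[of _ "DH \<circ> DK"]) (simp del: split_paired_All)
  qed
  ultimately show ?thesis
    using bij unfolding plane_symplectomorphism_def by (simp add: bij_comp)
qed

lemma plane_symplectomorphism_inv:
  assumes "plane_symplectomorphism H"
  shows "plane_symplectomorphism (inv H)"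
proof -
  have bij: "bij H" and dinv: "\<And>z. inv H differentiable (at z)"
    using assms unfolding plane_symplectomorphism_def by auto
  have "\<exists>D. (inv H has_derivative D) (at z) \<and>
        (\<forall>u v. symplectic_form (D u) (D v) = symplectic_form u v)" for z
  proof -
    obtain E where E: "(inv H has_derivative E) (at z)"
      using dinv unfolding differentiable_def by blast
    obtain D where D: "(H has_derivative D) (at (inv H z))"
        "\<forall>u v. symplectic_form (D u) (D v) = symplectic_form u v"
      using assms unfolding plane_symplectomorphism_def by blast
    have "H \<circ> inv H = id" using bij by (simp add: fun_eq_iff bij_is_surj surj_f_inv_f)
    then have "D \<circ> E = id"
      using diff_chain_at[OF E D(1)] has_derivative_id has_derivative_unique by (metis)
    then have "D (E u) = u" for u by (metis comp_apply id_apply)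
    then show ?thesis using E D(2) by metis
  qed
  moreover have "inv (inv H) = H" using bij by (rule inv_inv_eq)
  moreover have "H differentiable (at z)" for z
    using assms unfolding plane_symplectomorphism_def differentiable_def by blast
  ultimately show ?thesis
    using bij unfolding plane_symplectomorphism_def by (simp add: bij_imp_bij_inv)
qed

text \<open>
  Area preservation, in the only form needed: a rectangle cannot be mapped into one of smaller
  area. The change of variables formula applies on \<open>real^2\<close>, to which the plane is carried by
  the coordinate isomorphism; the Jacobian determinant is the value of the symplectic form on the
  images of the two basis vectors.
\<close>

lemma plane_symplectomorphism_box:
  assumes H: "plane_symplectomorphism H"
    and le: "a \<le> b" "c \<le> d"
    and sub: "H ` cbox (a, c) (b, d) \<subseteq> cbox (a', c') (b', d')"
  shows "(b - a) * (d - c) \<le> (b' - a') * (d' - c')"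
proof -
  define p :: "real^2 \<Rightarrow> plane" where "p v = (v $ 1, v $ 2)" for v
  define q :: "plane \<Rightarrow> real^2" where "q z = vector [fst z, snd z]" for z
  define B :: "real \<Rightarrow> real \<Rightarrow> real \<Rightarrow> real \<Rightarrow> (real^2) set"
    where "B a c b d = cbox (vector [a, c]) (vector [b, d])" for a c b d
  have linp: "bounded_linear p"
    unfolding p_def by (intro bounded_linear_Pair bounded_linear_vec_nth)
  have linq: "bounded_linear q"
    by (rule linear_conv_bounded_linear[THEN iffD1], rule linearI)
      (simp_all add: q_def vec_eq_iff forall_2)
  have pq: "q (p v) = v" "p (q z) = z" for v z
    by (simp_all add: p_def q_def vec_eq_iff forall_2)
  have memB: "v \<in> B a c b d \<longleftrightarrow> p v \<in> cbox (a, c) (b, d)" for v a b c d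
    unfolding B_def p_def mem_box_cart forall_2 cbox_Pair_eq by auto
  have content: "measure lebesgue (B a c b d) = (b - a) * (d - c)" if "a \<le> b" "c \<le> d" for a b c d
  proof -
    have "vector [a, c] \<in> B a c b d" using that unfolding B_def mem_box_cart forall_2 by simp
    then have "B a c b d \<noteq> {}" by blast
    then show ?thesis unfolding B_def by (simp add: content_cbox_cart UNIV_2)
  qed
  obtain D where D: "\<And>z. (H has_derivative D z) (at z)"
      "\<And>z u v. symplectic_form (D z u) (D z v) = symplectic_form u v"
    using H unfolding plane_symplectomorphism_def by metis
  let ?F = "\<lambda>v. q (H (p v))" and ?F' = "\<lambda>v w. q (D (p v) (p w))"
  have der: "(?F has_derivative ?F' v) (at v within B a c b d)" for v
  proof -
    have "(p has_derivative p) (at v)" using linp by (rule bounded_linear_imp_has_derivative)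
    moreover have "(q has_derivative q) (at z)" for z
      using linq by (rule bounded_linear_imp_has_derivative)
    ultimately have "(q \<circ> (H \<circ> p) has_derivative q \<circ> (D (p v) \<circ> p)) (at v)"
      using D(1) by (intro diff_chain_at) auto
    then show ?thesis by (simp add: o_def has_derivative_at_withinI)
  qed
  have det1: "det (matrix (?F' v)) = 1" for v
  proof -
    have "det (matrix (?F' v)) = symplectic_form (D (p v) (1, 0)) (D (p v) (0, 1))"
      unfolding det_2 matrix_def symplectic_form_def q_def p_def by (simp add: axis_def)
    also have "\<dots> = 1" unfolding D(2) by (simp add: symplectic_form_def)
    finally show ?thesis .
  qed
  have int: "(\<lambda>v. \<bar>det (matrix (?F' v))\<bar>) integrable_on B a c b d"
    unfolding det1 B_def using integrable_const by simp
  have Bm: "B a c b d \<in> lmeasurable" for a b c d unfolding B_def by simp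
  have inj: "inj_on ?F (B a c b d)"
  proof (rule inj_onI)
    fix v w assume "?F v = ?F w"
    then have "H (p v) = H (p w)" using pq(2) by metis
    then have "p v = p w"
      using H unfolding plane_symplectomorphism_def by (meson bij_is_inj injD)
    then show "v = w" using pq(1) by metis
  qed
  have FB: "?F ` B a c b d \<in> lmeasurable"
    using measurable_differentiable_image_eq[OF fmeasurableD[OF Bm] der inj] int by simp
  have "measure lebesgue (?F ` B a c b d) = integral (B a c b d) (\<lambda>v. \<bar>det (matrix (?F' v))\<bar>)"
    by (rule measure_differentiable_image_eq[OF fmeasurableD[OF Bm] der inj int])
  also have "\<dots> = measure lebesgue (B a c b d)"
    unfolding det1 using Bm by (simp add: lmeasure_integral)
  finally have eq: "measure lebesgue (?F ` B a c b d) = (b - a) * (d - c)"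
    using content le by simp
  have im: "?F ` B a c b d \<subseteq> B a' c' b' d'"
  proof
    fix w assume "w \<in> ?F ` B a c b d"
    then obtain v where v: "v \<in> B a c b d" "w = ?F v" by blast
    have "H (p v) \<in> cbox (a', c') (b', d')" using sub v(1) unfolding memB by blast
    then show "w \<in> B a' c' b' d'" unfolding memB v(2) pq .
  qed
  have "H (a, c) \<in> cbox (a', c') (b', d')" using sub le by (auto simp: cbox_Pair_eq)
  then have le': "a' \<le> b'" "c' \<le> d'" by (auto simp: cbox_Pair_eq mem_Times_iff)
  show ?thesis
    using measure_mono_fmeasurable[OF im fmeasurableD[OF FB] Bm] eq content[OF le'] by simp
qed

section \<open>Locally uniform limits of symplectic diffeomorphisms\<close>

definition C0_symplectic :: "(plane \<Rightarrow> plane) \<Rightarrow> bool" where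
  "C0_symplectic G \<longleftrightarrow>
     (\<exists>G'. homeomorphism UNIV UNIV G G') \<and>
     (\<forall>R. \<forall>\<epsilon>>0. \<exists>H. plane_symplectomorphism H \<and> (\<forall>z\<in>cball 0 R. dist (H z) (G z) < \<epsilon>))"

lemma C0_symplecticD:
  assumes "C0_symplectic G"
  shows "bij G" "continuous_on S G" "continuous_on S (inv G)"
    "homeomorphism UNIV UNIV G (inv G)"
proof -
  obtain G' where G': "homeomorphism UNIV UNIV G G'"
    using assms unfolding C0_symplectic_def by blast
  then have "G' = inv G"
    by (metis UNIV_I ext homeomorphism_def inv_unique_comp comp_apply id_apply)
  then show *: "homeomorphism UNIV UNIV G (inv G)" using G' by simp
  show "bij G" using * unfolding homeomorphism_def by (metis UNIV_I bijI')
  show "continuous_on S G" "continuous_on S (inv G)"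
    using * unfolding homeomorphism_def by (meson continuous_on_subset subset_UNIV)+
qed

lemma C0_symplectic_approx:
  assumes "C0_symplectic G" "bounded K" "\<epsilon> > 0"
  obtains H where "plane_symplectomorphism H" "\<And>z. z \<in> K \<Longrightarrow> dist (H z) (G z) < \<epsilon>"
proof -
  obtain R where R: "K \<subseteq> cball 0 R" using assms(2) bounded_subset_ballD[of K 0] ball_subset_cball by blast
  show ?thesis using assms(1,3) R that unfolding C0_symplectic_def by (metis subsetD)
qed

lemma C0_symplectic_comp:
  assumes F: "C0_symplectic F" and G: "C0_symplectic G"
  shows "C0_symplectic (F \<circ> G)"
  unfolding C0_symplectic_def
proof (intro conjI allI impI)
  show "\<exists>G'. homeomorphism UNIV UNIV (F \<circ> G) G'"
    using homeomorphism_compose[OF C0_symplecticD(4)[OF G] C0_symplecticD(4)[OF F]] by blast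
  fix R \<epsilon> :: real assume e: "\<epsilon> > 0"
  have "compact (G ` cball 0 R)"
    using C0_symplecticD(2)[OF G] by (intro compact_continuous_image) auto
  then have "bounded (G ` cball 0 R)" by (rule compact_imp_bounded)
  then obtain S where S: "G ` cball 0 R \<subseteq> cball 0 S"
    using bounded_subset_ballD ball_subset_cball by (metis order_trans)
  have "uniformly_continuous_on (cball 0 (S + 1)) F"
    using C0_symplecticD(2)[OF F] by (intro compact_uniformly_continuous) auto
  then obtain \<delta> where \<delta>: "\<delta> > 0"
    "\<And>x y. x \<in> cball 0 (S + 1) \<Longrightarrow> y \<in> cball 0 (S + 1) \<Longrightarrow> dist y x < \<delta> \<Longrightarrow> dist (F y) (F x) < \<epsilon> / 2"
    using e unfolding uniformly_continuous_on_def by (metis half_gt_zero)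
  obtain H where H: "plane_symplectomorphism H"
      "\<And>z. z \<in> cball 0 (S + 1) \<Longrightarrow> dist (H z) (F z) < \<epsilon> / 2"
    using C0_symplectic_approx[OF F bounded_cball half_gt_zero[OF e]] by blast
  obtain K where K: "plane_symplectomorphism K"
      "\<And>z. z \<in> cball 0 R \<Longrightarrow> dist (K z) (G z) < min 1 \<delta>"
    using C0_symplectic_approx[OF G bounded_cball, of "min 1 \<delta>" 0 R] \<delta>(1) by auto
  have "dist ((H \<circ> K) z) ((F \<circ> G) z) < \<epsilon>" if z: "z \<in> cball 0 R" for z
  proof -
    have Gz: "G z \<in> cball 0 S" using S z by blast
    have dK: "dist (K z) (G z) < 1" "dist (K z) (G z) < \<delta>" using K(2)[OF z] by auto
    have "dist 0 (K z) \<le> dist 0 (G z) + dist (K z) (G z)"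
      by (metis dist_commute dist_triangle)
    then have Kz: "K z \<in> cball 0 (S + 1)" using Gz dK by simp
    have "dist (H (K z)) (F (K z)) < \<epsilon> / 2" using H(2)[OF Kz] .
    moreover have "dist (F (K z)) (F (G z)) < \<epsilon> / 2" using \<delta>(2)[of "G z"] Kz Gz dK by simp
    ultimately show ?thesis using dist_triangle_half_l[of "H (K z)" "F (K z)" \<epsilon> "F (G z)"]
      by (metis comp_apply dist_triangle_half_r dist_commute)
  qed
  then show "\<exists>H. plane_symplectomorphism H \<and> (\<forall>z\<in>cball 0 R. dist (H z) ((F \<circ> G) z) < \<epsilon>)"
    using plane_symplectomorphism_comp[OF H(1) K(1)] by blast
qed

text \<open>
  If \<open>H\<close> is \<open>\<eta>\<close>-close to \<open>G\<close> on a large compact set, then \<open>H \<circ> G\<inverse>\<close> is \<open>\<eta>\<close>-close to the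
  identity on \<open>cball y \<eta>\<close>, and by Brouwer's theorem it takes the value \<open>y\<close> at some \<open>w\<close> in that
  ball. So \<open>H\<inverse> y = G\<inverse> w\<close>, which is close to \<open>G\<inverse> y\<close> by uniform continuity.
\<close>

lemma C0_symplectic_inv:
  assumes G: "C0_symplectic G"
  shows "C0_symplectic (inv G)"
  unfolding C0_symplectic_def
proof (intro conjI allI impI)
  show "\<exists>G'. homeomorphism UNIV UNIV (inv G) G'"
    using C0_symplecticD(4)[OF G] homeomorphism_symD by blast
  fix R \<epsilon> :: real assume e: "\<epsilon> > 0"
  have "uniformly_continuous_on (cball 0 (R + 1)) (inv G)"
    using C0_symplecticD(3)[OF G] by (intro compact_uniformly_continuous) auto
  then obtain \<delta> where \<delta>: "\<delta> > 0"
    "\<And>x y. x \<in> cball 0 (R + 1) \<Longrightarrow> y \<in> cball 0 (R + 1) \<Longrightarrow> dist y x < \<delta>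
        \<Longrightarrow> dist (inv G y) (inv G x) < \<epsilon>"
    using e unfolding uniformly_continuous_on_def by metis
  define \<eta> where "\<eta> = min 1 (\<delta> / 2)"
  have \<eta>: "0 < \<eta>" "\<eta> \<le> 1" "\<eta> < \<delta>" using \<delta>(1) by (auto simp: \<eta>_def)
  have "compact (inv G ` cball 0 (R + 1))"
    using C0_symplecticD(3)[OF G] by (intro compact_continuous_image) auto
  then obtain H where H: "plane_symplectomorphism H"
      "\<And>z. z \<in> inv G ` cball 0 (R + 1) \<Longrightarrow> dist (H z) (G z) < \<eta>"
    using C0_symplectic_approx[OF G compact_imp_bounded \<eta>(1)] by blast
  have "dist (inv H y) (inv G y) < \<epsilon>" if y: "y \<in> cball 0 R" for y
  proof -
    \<comment> \<open>A fixed point of \<open>T\<close> is a solution \<open>w\<close> of \<open>H (G\<inverse> w) = y\<close>.\<close>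
    define T where "T w = w - H (inv G w) + y" for w
    have cball: "w \<in> cball 0 (R + 1)" if "w \<in> cball y \<eta>" for w
    proof -
      have "dist 0 w \<le> dist 0 y + dist y w" by (rule dist_triangle)
      then show ?thesis using that y \<eta> by simp
    qed
    have "continuous_on (cball y \<eta>) T" unfolding T_def
      by (intro continuous_intros C0_symplecticD(3)[OF G]
          continuous_on_compose2[OF plane_symplectomorphism_continuous[OF H(1), of UNIV]]) auto
    moreover have "T \<in> cball y \<eta> \<rightarrow> cball y \<eta>"
    proof
      fix w assume w: "w \<in> cball y \<eta>"
      have "G (inv G w) = w" using C0_symplecticD(1)[OF G] by (simp add: bij_is_surj surj_f_inv_f)
      then have "dist (H (inv G w)) w < \<eta>" using H(2)[of "inv G w"] cball[OF w] by auto
      moreover have "dist y (T w) = dist (H (inv G w)) w"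
        unfolding T_def dist_norm by (simp add: algebra_simps)
      ultimately show "T w \<in> cball y \<eta>" by simp
    qed
    ultimately obtain w where w: "w \<in> cball y \<eta>" "T w = w"
      using brouwer_ball[OF \<eta>(1)] by blast
    have "H (inv G w) = y" using w(2) by (simp add: T_def)
    then have "inv H y = inv G w"
      using H(1) unfolding plane_symplectomorphism_def by (metis bij_inv_eq_iff)
    moreover have "dist (inv G w) (inv G y) < \<epsilon>"
      using w(1) \<eta> cball[of w] y by (intro \<delta>(2)) (auto simp: dist_commute)
    ultimately show ?thesis by simp
  qed
  then show "\<exists>H. plane_symplectomorphism H \<and> (\<forall>z\<in>cball 0 R. dist (H z) (inv G z) < \<epsilon>)"
    using plane_symplectomorphism_inv[OF H(1)] by blast
qed

section \<open>Winding numbers and orientation\<close>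

lemma winding_number_part_circlepath_centre:
  assumes "r \<noteq> 0"
  shows "winding_number (part_circlepath 0 r s t) 0 = (t - s) / (2 * pi)"
proof -
  let ?\<gamma> = "part_circlepath 0 r s t"
  have nz: "0 \<notin> path_image ?\<gamma>"
    using assms by (auto simp: path_image_def part_circlepath_def)
  have "((\<lambda>x. \<i> * of_real (t - s)) has_integral \<i> * of_real (t - s)) {0..1::real}"
    using has_integral_const_real[of "\<i> * of_real (t - s)" 0 1] by simp
  then have "((\<lambda>w. 1 / (w - 0)) has_contour_integral \<i> * of_real (t - s)) ?\<gamma>"
    unfolding has_contour_integral_def
  proof (rule has_integral_eq[rotated])
    fix x :: real assume "x \<in> {0..1}"
    then have "vector_derivative ?\<gamma> (at x within {0..1}) = \<i> * of_real (t - s) * ?\<gamma> x"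
      by (subst vector_derivative_part_circlepath01)
        (auto simp: part_circlepath_def mult_ac)
    moreover have "?\<gamma> x \<noteq> 0" using assms by (simp add: part_circlepath_def)
    ultimately show "\<i> * of_real (t - s) =
        1 / (?\<gamma> x - 0) * vector_derivative ?\<gamma> (at x within {0..1})" by simp
  qed
  then show ?thesis
    using winding_number_valid_path[OF valid_path_part_circlepath nz]
    by (simp add: contour_integral_unique)
qed

definition to_complex :: "plane \<Rightarrow> complex" where
  "to_complex z = Complex (fst z) (snd z)"

lemma to_complex_sel [simp]: "Re (to_complex z) = fst z" "Im (to_complex z) = snd z"
  by (simp_all add: to_complex_def)

definition circle_at :: "real \<Rightarrow> real \<Rightarrow> plane" where
  "circle_at r t = (r * cos (2 * pi * t), r * sin (2 * pi * t))"

lemma norm_to_complex: "norm (to_complex z) = norm z"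
  by (simp add: norm_prod_def cmod_def)

lemma continuous_on_to_complex [continuous_intros]:
  "continuous_on S f \<Longrightarrow> continuous_on S (\<lambda>x. to_complex (f x))"
  unfolding to_complex_def Complex_eq by (intro continuous_intros) auto

lemma continuous_on_circle_at [continuous_intros]:
  fixes S :: "'a::t2_space set"
  assumes "continuous_on S f" "continuous_on S g"
  shows "continuous_on S (\<lambda>x. circle_at (f x) (g x))"
  unfolding circle_at_def by (intro continuous_intros assms)

lemma norm_circle_at: "norm (circle_at r t) = \<bar>r\<bar>"
proof -
  have "(r * cos (2 * pi * t))\<^sup>2 + (r * sin (2 * pi * t))\<^sup>2
      = r\<^sup>2 * ((sin (2 * pi * t))\<^sup>2 + (cos (2 * pi * t))\<^sup>2)"
    by (simp only: power_mult_distrib distrib_left add.commute)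
  then show ?thesis by (simp add: circle_at_def norm_Pair)
qed

lemma circle_at_closed: "circle_at r 1 = circle_at r 0"
  by (simp add: circle_at_def)

lemma to_complex_simps:
  "to_complex (u - v) = to_complex u - to_complex v"
  "to_complex u = 0 \<longleftrightarrow> u = 0"
  by (simp_all add: complex_eq_iff prod_eq_iff)

text \<open>
  In complex notation the linear map is \<open>z \<mapsto> \<alpha> z + \<beta> cnj z\<close>, with determinant
  \<open>\<bar>\<alpha>\<bar>\<^sup>2 - \<bar>\<beta>\<bar>\<^sup>2\<close>. As this is positive, the conformal part dominates and the image of the circle
  is homotopic, away from the origin, to \<open>\<alpha>\<close> times the circle.
\<close>

lemma winding_number_linear_symplectic:
  assumes D: "linear D" "\<And>u v. symplectic_form (D u) (D v) = symplectic_form u v"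
    and r: "r > 0"
  shows "winding_number (\<lambda>t. to_complex (D (circle_at r t))) 0 = 1"
proof -
  obtain a c where ac: "D (1, 0) = (a, c)" by fastforce
  obtain b d where bd: "D (0, 1) = (b, d)" by fastforce
  have det: "a * d - c * b = 1"
    using D(2)[of "(1, 0)" "(0, 1)"] ac bd by (simp add: symplectic_form_def)
  have Dxy: "D (x, y) = (x * a + y * b, x * c + y * d)" for x y
  proof -
    have "D (x, y) = D (x *\<^sub>R (1, 0) + y *\<^sub>R (0, 1))" by simp
    also have "\<dots> = x *\<^sub>R D (1, 0) + y *\<^sub>R D (0, 1)"
      using D(1) by (simp only: linear_add linear_scale)
    finally show ?thesis using ac bd by simp
  qed
  define \<alpha> where "\<alpha> = Complex ((a + d) / 2) ((c - b) / 2)"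
  define \<beta> where "\<beta> = Complex ((a - d) / 2) ((c + b) / 2)"
  have "(cmod \<alpha>)\<^sup>2 - (cmod \<beta>)\<^sup>2 = a * d - c * b"
    unfolding \<alpha>_def \<beta>_def cmod_power2 by (simp add: power2_eq_square field_simps)
  then have "(cmod \<beta>)\<^sup>2 < (cmod \<alpha>)\<^sup>2" using det by simp
  then have lt: "cmod \<beta> < cmod \<alpha>" by (rule power2_less_imp_less) simp
  define s where "s = Arg \<alpha>"
  have \<alpha>: "\<alpha> = cmod \<alpha> * exp (\<i> * s)" unfolding s_def using lt by (intro Arg_eq) auto
  let ?g = "part_circlepath 0 (cmod \<alpha> * r) s (s + 2 * pi)"
  let ?h = "\<lambda>t. to_complex (D (circle_at r t))"
  have e: "exp (\<i> * (2 * pi * t)) = Complex (cos (2 * pi * t)) (sin (2 * pi * t))" for t :: real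
    using cis_conv_exp[of "2 * pi * t"] by (simp add: complex_eq_iff)
  have g: "?g t = \<alpha> * (r * exp (\<i> * (2 * pi * t)))" for t
  proof -
    have "?g t = cmod \<alpha> * r * exp (\<i> * s + \<i> * (2 * pi * t))"
      unfolding part_circlepath_def linepath_def by (simp add: algebra_simps)
    also have "\<dots> = (cmod \<alpha> * exp (\<i> * s)) * (r * exp (\<i> * (2 * pi * t)))"
      by (simp add: exp_add)
    finally show ?thesis using \<alpha> by simp
  qed
  have h: "?h t = ?g t + \<beta> * cnj (r * exp (\<i> * (2 * pi * t)))" for t
    unfolding g
    unfolding e circle_at_def Dxy \<alpha>_def \<beta>_def
    by (simp add: complex_eq_iff field_simps)
  have "winding_number ?h 0 = winding_number ?g 0"
  proof (rule winding_number_nearby_loops_eq)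
    show "path ?h" unfolding path_def
      by (intro continuous_intros linear_continuous_on_compose[OF _ D(1)])
    show "pathfinish ?h = pathstart ?h" by (simp add: pathfinish_def pathstart_def circle_at_closed)
    show "pathfinish ?g = pathstart ?g"
      by (simp add: exp_add algebra_simps exp_two_pi_i')
    fix t :: real
    have "norm (?h t - ?g t) = cmod \<beta> * r" unfolding h using r by (simp add: norm_mult)
    moreover have "norm (?g t - 0) = cmod \<alpha> * r" unfolding g using r by (simp add: norm_mult)
    ultimately show "norm (?h t - ?g t) < norm (?g t - 0)" using lt r by simp
  qed auto
  also have "\<dots> = 1"
    using r lt by (subst winding_number_part_circlepath_centre) auto
  finally show ?thesis .
qed

text \<open>
  Injectivity lets the circle shrink towards its centre without its image meeting the image of
  the centre; on a small enough circle the map is dominated by its derivative.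
\<close>

lemma winding_number_plane_symplectomorphism:
  assumes H: "plane_symplectomorphism H" and r: "r > 0"
  shows "winding_number (\<lambda>t. to_complex (H (p + circle_at r t) - H p)) 0 = 1"
proof -
  have inj: "H x = H y \<longleftrightarrow> x = y" for x y
    using H unfolding plane_symplectomorphism_def by (meson bij_is_inj inj_eq)
  note contH = continuous_on_compose2[OF plane_symplectomorphism_continuous[OF H, of UNIV]]
  obtain D where D: "(H has_derivative D) (at p)"
      "\<And>u v. symplectic_form (D u) (D v) = symplectic_form u v"
    using H unfolding plane_symplectomorphism_def by blast
  have lin: "linear D" using D(1) has_derivative_linear by blast
  have "inj D"
  proof (subst linear_injective_0[OF lin], intro allI impI)
    fix u assume "D u = 0"
    then have "symplectic_form u v = 0" for v using D(2)[of u v] by (simp add: symplectic_form_def)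
    from this[of "(1, 0)"] this[of "(0, 1)"] show "u = 0"
      by (simp add: symplectic_form_def prod_eq_iff)
  qed
  then obtain m where m: "m > 0" "\<And>v. m * norm v \<le> norm (D v)"
    using linear_inj_bounded_below_pos[OF lin] by metis
  obtain \<delta> where \<delta>: "\<delta> > 0"
    "\<And>y. norm (y - p) < \<delta> \<Longrightarrow> norm (H y - H p - D (y - p)) \<le> m / 2 * norm (y - p)"
    using D(1) m(1) unfolding has_derivative_at_alt by (metis half_gt_zero)
  define s where "s = min 1 (\<delta> / (2 * r))"
  have s: "0 < s" "s \<le> 1" "s * r < \<delta>"
    using \<delta>(1) r by (auto simp: s_def min_def field_simps)
  let ?g = "\<lambda>t. to_complex (H (p + circle_at r t) - H p)"
  let ?k = "\<lambda>t. to_complex (H (p + circle_at (s * r) t) - H p)"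
  let ?d = "\<lambda>t. to_complex (D (circle_at (s * r) t))"
  have "homotopic_loops (- {0}) ?g ?k"
    unfolding homotopic_loops
  proof (intro exI conjI ballI)
    let ?h = "\<lambda>x. to_complex (H (p + circle_at ((1 - fst x * (1 - s)) * r) (snd x)) - H p)"
    show "continuous_on ({0..1} \<times> {0..1}) ?h" by (intro continuous_intros contH) auto
    show "?h \<in> {0..1} \<times> {0..1} \<rightarrow> - {0}"
    proof
      fix x :: "real \<times> real" assume "x \<in> {0..1} \<times> {0..1}"
      then have "0 \<le> fst x" "fst x \<le> 1" by auto
      then have "fst x * (1 - s) \<le> 1 * (1 - s)" using s by (intro mult_right_mono) auto
      then have "(1 - fst x * (1 - s)) * r > 0" using s r by simp
      then have "norm (circle_at ((1 - fst x * (1 - s)) * r) (snd x)) \<noteq> 0"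
        unfolding norm_circle_at by (metis abs_eq_0 less_irrefl)
      then have "p + circle_at ((1 - fst x * (1 - s)) * r) (snd x) \<noteq> p" by auto
      then show "?h x \<in> - {0}" by (simp only: Compl_iff singleton_iff to_complex_simps(2) right_minus_eq inj) simp
    qed
    show "pathfinish (?h \<circ> Pair t) = pathstart (?h \<circ> Pair t)" for t
      by (simp add: pathfinish_def pathstart_def circle_at_closed)
  qed auto
  then have "winding_number ?g 0 = winding_number ?k 0"
    by (rule winding_number_homotopic_loops)
  also have "\<dots> = winding_number ?d 0"
  proof (rule winding_number_nearby_loops_eq)
    show "path ?k" unfolding path_def by (intro continuous_intros contH) auto
    show "path ?d" unfolding path_def
      by (intro continuous_intros linear_continuous_on_compose[OF _ lin])
    fix t :: real
    let ?v = "circle_at (s * r) t"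
    have nv: "norm ?v = s * r" unfolding norm_circle_at using s r by simp
    have "norm (?k t - ?d t) = norm (H (p + ?v) - H p - D ?v)"
      by (simp only: flip: to_complex_simps(1)) (simp only: norm_to_complex)
    also have "\<dots> \<le> m / 2 * norm ?v" using \<delta>(2)[of "p + ?v"] nv s by simp
    also have "\<dots> < m * norm ?v" using nv s(1) r m(1) by simp
    also have "\<dots> \<le> norm (D ?v)" using m(2) .
    also have "\<dots> = norm (?d t - 0)" by (simp add: norm_to_complex)
    finally show "norm (?k t - ?d t) < norm (?d t - 0)" .
  qed (simp_all add: pathfinish_def pathstart_def circle_at_closed)
  also have "\<dots> = 1"
    using s r by (intro winding_number_linear_symplectic lin D(2)) simp
  finally show ?thesis .
qed

text \<open>
  The image of the circle stays at a positive distance from the image of its centre, so an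
  approximation closer than half that distance gives the same winding number.
\<close>

lemma winding_number_C0_symplectic:
  assumes G: "C0_symplectic G" and r: "r > 0"
  shows "winding_number (\<lambda>t. to_complex (G (p + circle_at r t) - G p)) 0 = 1"
proof -
  have inj: "G x = G y \<longleftrightarrow> x = y" for x y
    using C0_symplecticD(1)[OF G] by (meson bij_is_inj inj_eq)
  note contG = continuous_on_compose2[OF C0_symplecticD(2)[OF G, of UNIV]]
  let ?g = "\<lambda>t. to_complex (G (p + circle_at r t) - G p)"
  have pg: "path ?g" unfolding path_def by (intro continuous_intros contG) auto
  have "0 \<notin> path_image ?g"
  proof
    assume "0 \<in> path_image ?g"
    then obtain t where "?g t = 0" by (auto simp: path_image_def)
    then have "circle_at r t = 0" by (simp only: to_complex_simps(2) right_minus_eq inj) simp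
    then show False using norm_circle_at[of r t] r by simp
  qed
  then obtain m where m: "m > 0" "\<And>z. z \<in> path_image ?g \<Longrightarrow> m \<le> dist 0 z"
    using separate_point_closed[of "path_image ?g" 0] closed_path_image[OF pg] by blast
  obtain H where H: "plane_symplectomorphism H"
    "\<And>z. z \<in> cball p r \<Longrightarrow> dist (H z) (G z) < m / 2"
    using C0_symplectic_approx[OF G bounded_cball half_gt_zero[OF m(1)]] by blast
  let ?h = "\<lambda>t. to_complex (H (p + circle_at r t) - H p)"
  have "winding_number ?h 0 = winding_number ?g 0"
  proof (rule winding_number_nearby_loops_eq[OF pg])
    show "path ?h" unfolding path_def
      by (intro continuous_intros
          continuous_on_compose2[OF plane_symplectomorphism_continuous[OF H(1), of UNIV]]) auto
    fix t :: real assume t: "t \<in> {0..1}"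
    let ?q = "p + circle_at r t"
    have q: "?q \<in> cball p r" using norm_circle_at[of r t] r by (simp add: dist_norm)
    have "norm (?h t - ?g t) = norm ((H ?q - G ?q) - (H p - G p))"
      by (simp only: norm_to_complex flip: to_complex_simps(1)) (simp add: algebra_simps)
    also have "\<dots> \<le> dist (H ?q) (G ?q) + dist (H p) (G p)"
      unfolding dist_norm by (rule norm_triangle_ineq4)
    also have "\<dots> < m" using H(2)[OF q] H(2)[of p] r by simp
    also have "\<dots> \<le> norm (?g t - 0)" using m(2)[of "?g t"] t by (simp add: path_image_def)
    finally show "norm (?h t - ?g t) < norm (?g t - 0)" .
  qed (simp_all add: pathfinish_def pathstart_def circle_at_closed)
  then show ?thesis using winding_number_plane_symplectomorphism[OF H(1) r] by simp
qed

section \<open>Maps preserving the horizontal lines\<close>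

text \<open>
  On each horizontal line \<open>G\<close> is continuous and injective, hence strictly monotone. If it were
  decreasing on \<open>[a, b] \<times> {s}\<close>, the displacement of \<open>G\<close> along the circle with
  diameter \<open>[a, b] \<times> {s}\<close> could be joined to the reflection \<open>(x, y) \<mapsto> (-x, y)\<close> of that circle by
  straight segments avoiding the origin: off the diameter both have the same nonzero vertical
  component, and at its two ends both are horizontal and point the same way. The reflected circle
  has winding number \<open>-1\<close>.
\<close>

lemma C0_symplectic_fibre_increasing:
  assumes G: "C0_symplectic G" and hor: "\<And>z. snd (G z) = snd z" and ab: "a < b"
  shows "fst (G (a, s)) < fst (G (b, s))"
proof (rule ccontr)
  assume nle: "\<not> ?thesis"
  let ?u = "\<lambda>x. fst (G (x, s))"
  define m r where "m = (a + b) / 2" and "r = (b - a) / 2"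
  have mr: "a < m" "m < b" "r > 0" "m + r = b" "m - r = a" using ab by (auto simp: m_def r_def field_simps)
  have inj: "G x = G y \<longleftrightarrow> x = y" for x y
    using C0_symplecticD(1)[OF G] by (meson bij_is_inj inj_eq)
  note contG = continuous_on_compose2[OF C0_symplecticD(2)[OF G, of UNIV]]
  have "continuous_on {a..b} ?u" by (intro continuous_intros contG) auto
  moreover have "inj_on ?u {a..b}"
  proof (rule inj_onI)
    fix x y assume "?u x = ?u y"
    then have "G (x, s) = G (y, s)" using hor by (simp add: prod_eq_iff)
    then show "x = y" unfolding inj by simp
  qed
  ultimately have dec: "?u b < ?u m" "?u m < ?u a"
    using continuous_inj_imp_mono[OF mr(1,2), of ?u] nle by auto
  let ?p = "(m, s)"
  let ?g = "\<lambda>t. to_complex (G (?p + circle_at r t) - G ?p)"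
  \<comment> \<open>The reflected circle, traversed clockwise from \<open>-r\<close>.\<close>
  let ?f = "part_circlepath 0 r pi (- pi)"
  have f: "?f t = Complex (- r * cos (2 * pi * t)) (r * sin (2 * pi * t))" for t
  proof -
    have "?f t = r * cis (pi - 2 * pi * t)"
      unfolding part_circlepath_def linepath_def cis_conv_exp by (simp add: algebra_simps)
    then show ?thesis by (simp add: complex_eq_iff cos_diff sin_diff)
  qed
  have "winding_number ?g 0 = winding_number ?f 0"
  proof (rule winding_number_loops_linear_eq)
    show "path ?g" unfolding path_def by (intro continuous_intros contG) auto
    show "pathfinish ?f = pathstart ?f" by (simp add: exp_minus)
    fix t :: real
    show "0 \<notin> closed_segment (?f t) (?g t)"
    proof
      assume "0 \<in> closed_segment (?f t) (?g t)"
      then obtain u where u: "0 \<le> u" "u \<le> 1" "(1 - u) *\<^sub>R ?f t + u *\<^sub>R ?g t = 0"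
        unfolding closed_segment_def by auto
      have "(1 - u) * Im (?f t) + u * Im (?g t) = 0"
        using arg_cong[OF u(3), of Im] by simp
      then have "r * sin (2 * pi * t) = 0"
        unfolding f by (simp add: hor circle_at_def algebra_simps)
      then have sin0: "sin (2 * pi * t) = 0" using mr(3) by simp
      have re: "(1 - u) * Re (?f t) + u * Re (?g t) = 0"
        using arg_cong[OF u(3), of Re] by simp
      have "cos (2 * pi * t) = 1 \<or> cos (2 * pi * t) = -1"
        using sin0 sin_zero_abs_cos_one by fastforce
      then show False
      proof
        assume c: "cos (2 * pi * t) = 1"
        have "(1 - u) * r + u * (?u m - ?u b) = 0"
          using re unfolding f circle_at_def c sin0 using mr(4) by (simp add: algebra_simps)
        moreover have "(1 - u) * r + u * (?u m - ?u b) > 0"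
          using u(1,2) dec(1) mr(3)
          by (cases "u = 0") (auto intro: add_nonneg_pos)
        ultimately show False by simp
      next
        assume c: "cos (2 * pi * t) = -1"
        have "(1 - u) * r + u * (?u a - ?u m) = 0"
          using re unfolding f circle_at_def c sin0 using mr(5) by (simp add: algebra_simps)
        moreover have "(1 - u) * r + u * (?u a - ?u m) > 0"
          using u(1,2) dec(2) mr(3)
          by (cases "u = 0") (auto intro: add_nonneg_pos)
        ultimately show False by simp
      qed
    qed
  qed (simp_all add: pathfinish_def pathstart_def circle_at_closed)
  moreover have "winding_number ?f 0 = -1"
    using mr(3) by (subst winding_number_part_circlepath_centre) auto
  ultimately show False using winding_number_C0_symplectic[OF G mr(3), of ?p] by simp
qed

text \<open>
  Suppose the image \<open>[A, B] \<times> {s}\<close> of \<open>[a, b] \<times> {s}\<close> is shorter than \<open>b - a\<close>. By continuity and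
  monotonicity the image of a thin rectangle \<open>[a, b] \<times> [s - h, s + h]\<close> lies in the product of an
  interval slightly larger than \<open>[A, B]\<close> with \<open>[s - h, s + h]\<close>. A symplectic diffeomorphism close
  to \<open>G\<close> maps the rectangle into a slight enlargement of that product, whose area is still too
  small.
\<close>

lemma C0_symplectic_fibre_expanding:
  assumes G: "C0_symplectic G" and hor: "\<And>z. snd (G z) = snd z" and ab: "a < b"
  shows "b - a \<le> fst (G (b, s)) - fst (G (a, s))"
proof (rule ccontr)
  assume nle: "\<not> ?thesis"
  define A B \<eta> where "A = fst (G (a, s))" and "B = fst (G (b, s))"
    and "\<eta> = ((b - a) - (B - A)) / 8"
  have \<eta>: "\<eta> > 0" using nle by (simp add: \<eta>_def A_def B_def)
  note contG = continuous_on_compose2[OF C0_symplecticD(2)[OF G, of UNIV]]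
  have "\<forall>\<^sub>F y in at s. dist (fst (G (x, y))) (fst (G (x, s))) < \<eta>" for x
  proof -
    have "continuous_on UNIV (\<lambda>y. fst (G (x, y)))" by (intro continuous_intros contG) auto
    then have "isCont (\<lambda>y. fst (G (x, y))) s" by (simp add: continuous_on_eq_continuous_at)
    then show ?thesis using \<eta> tendstoD unfolding isCont_def by blast
  qed
  from this[of a] this[of b] obtain \<delta> where \<delta>: "\<delta> > 0"
    "\<And>y. y \<noteq> s \<Longrightarrow> dist y s < \<delta> \<Longrightarrow> dist (fst (G (a, y))) A < \<eta> \<and> dist (fst (G (b, y))) B < \<eta>"
    using eventually_conj eventually_at A_def B_def by (smt (verit) UNIV_I)
  define h where "h = \<delta> / 2"
  have h: "h > 0" "h < \<delta>" using \<delta>(1) by (auto simp: h_def)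
  \<comment> \<open>The approximation also widens the rectangle vertically, by a total of \<open>2 * \<epsilon>\<close>; the bound
    \<open>h * \<eta> / (b - a)\<close> keeps the area gained this way below the area \<open>8 * h * \<eta>\<close> lost horizontally.\<close>
  define \<epsilon> where "\<epsilon> = min \<eta> (h * \<eta> / (b - a))"
  have \<epsilon>: "\<epsilon> > 0" "\<epsilon> \<le> \<eta>" "\<epsilon> * (b - a) \<le> h * \<eta>"
    using \<eta> h ab by (auto simp: \<epsilon>_def min_def field_simps)
  let ?K = "cbox (a, s - h) (b, s + h)"
  obtain H where H: "plane_symplectomorphism H" "\<And>z. z \<in> ?K \<Longrightarrow> dist (H z) (G z) < \<epsilon>"
    using C0_symplectic_approx[OF G bounded_cbox \<epsilon>(1)] by blast
  have "H ` ?K \<subseteq> cbox (A - 2 * \<eta>, s - h - \<epsilon>) (B + 2 * \<eta>, s + h + \<epsilon>)"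
  proof
    fix w assume "w \<in> H ` ?K"
    then obtain x y where xy: "w = H (x, y)" "a \<le> x" "x \<le> b" "s - h \<le> y" "y \<le> s + h"
      by (auto simp: cbox_Pair_eq)
    have "(x, y) \<in> ?K" using xy by (auto simp: cbox_Pair_eq)
    then have dw: "dist w (G (x, y)) < \<epsilon>" using H(2) xy(1) by simp
    have d: "\<bar>fst w - fst (G (x, y))\<bar> < \<epsilon>" "\<bar>snd w - y\<bar> < \<epsilon>"
      using dw dist_fst_le[of w "G (x, y)"] dist_snd_le[of w "G (x, y)"] hor[of "(x, y)"]
      by (auto simp: dist_real_def)
    have "dist (fst (G (a, y))) A < \<eta> \<and> dist (fst (G (b, y))) B < \<eta>"
      using \<delta>(2)[of y] \<eta> h xy(4,5) by (cases "y = s") (auto simp: A_def B_def dist_real_def)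
    moreover have "fst (G (a, y)) \<le> fst (G (x, y))" "fst (G (x, y)) \<le> fst (G (b, y))"
      using C0_symplectic_fibre_increasing[OF G hor, of a x y]
        C0_symplectic_fibre_increasing[OF G hor, of x b y] xy(2,3)
      by (cases "x = a"; cases "x = b"; force)+
    ultimately have "A - 2 * \<eta> \<le> fst w" "fst w \<le> B + 2 * \<eta>"
      using d(1) \<epsilon>(2) unfolding dist_real_def by linarith+
    moreover have "s - h - \<epsilon> \<le> snd w" "snd w \<le> s + h + \<epsilon>"
      using d(2) xy(4,5) by linarith+
    ultimately show "w \<in> cbox (A - 2 * \<eta>, s - h - \<epsilon>) (B + 2 * \<eta>, s + h + \<epsilon>)"
      by (simp add: cbox_Pair_eq mem_Times_iff)
  qed
  then have "(b - a) * ((s + h) - (s - h)) \<le>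
      ((B + 2 * \<eta>) - (A - 2 * \<eta>)) * ((s + h + \<epsilon>) - (s - h - \<epsilon>))"
    using ab h by (intro plane_symplectomorphism_box[OF H(1)]) auto
  also have "(B + 2 * \<eta>) - (A - 2 * \<eta>) = b - a - 4 * \<eta>" by (simp add: \<eta>_def field_simps)
  finally have "(b - a) * (2 * h) \<le> (b - a - 4 * \<eta>) * (2 * h + 2 * \<epsilon>)" by (simp add: algebra_simps)
  also have "\<dots> = (b - a) * (2 * h) + 2 * (\<epsilon> * (b - a)) - 8 * (h * \<eta>) - 8 * (\<eta> * \<epsilon>)"
    by (simp add: algebra_simps)
  also have "\<dots> < (b - a) * (2 * h)"
  proof -
    have "\<eta> * \<epsilon> > 0" "h * \<eta> > 0" using \<eta> h \<epsilon>(1) by auto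
    then show ?thesis using \<epsilon>(3) by linarith
  qed
  finally show False by simp
qed

text \<open>
  The inverse of \<open>G\<close> satisfies the same hypotheses, so neither of them contracts a horizontal
  segment, and both preserve the length of all of them.
\<close>

lemma C0_symplectic_fibre_translation:
  assumes G: "C0_symplectic G" and hor: "\<And>z. snd (G z) = snd z"
  shows "G (x, s) = (x + fst (G (0, s)), s)"
proof -
  have hor': "snd (inv G z) = snd z" for z
    using hor C0_symplecticD(1)[OF G] by (metis bij_inv_eq_iff)
  have inv: "inv G (G z) = z" for z
    using C0_symplecticD(1)[OF G] by (simp add: bij_is_inj)
  have *: "fst (G (b, s)) - fst (G (a, s)) = b - a" if ab: "a < b" for a b
  proof (rule antisym)
    let ?A = "fst (G (a, s))" and ?B = "fst (G (b, s))"
    have eq: "G (a, s) = (?A, s)" "G (b, s) = (?B, s)"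
      using hor by (simp_all add: prod_eq_iff)
    have "?B - ?A \<le> fst (inv G (?B, s)) - fst (inv G (?A, s))"
      using C0_symplectic_fibre_increasing[OF G hor ab]
      by (intro C0_symplectic_fibre_expanding C0_symplectic_inv G hor')
    then show "?B - ?A \<le> b - a" unfolding eq[symmetric] inv by simp
  qed (rule C0_symplectic_fibre_expanding[OF G hor ab])
  have "fst (G (x, s)) = x + fst (G (0, s))"
    using *[of 0 x] *[of x 0] by (cases x "0 :: real" rule: linorder_cases) auto
  then show ?thesis using hor by (simp add: prod_eq_iff)
qed

section \<open>Lifting to the universal cover\<close>

lemma circle_of_eq_iff: "circle_of x = circle_of y \<longleftrightarrow> x - y \<in> \<int>"
  by (rule circle.abs_eq_iff)

lemma surj_circle_of: "\<exists>x. t = circle_of x"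
  by (metis circle.abs_eq_iff Quotient_circle Quotient_abs_rep)

lemma annulus_of_eq_iff: "annulus_of z = annulus_of w \<longleftrightarrow> (\<exists>k::int. z = w + (of_int k, 0))"
proof
  assume "annulus_of z = annulus_of w"
  then have "fst z - fst w \<in> \<int>" "snd z = snd w"
    by (simp_all add: annulus_of_def circle_of_eq_iff)
  then obtain k :: int where "fst z - fst w = of_int k" unfolding Ints_def by blast
  then have "z = w + (of_int k, 0)" using \<open>snd z = snd w\<close> by (simp add: prod_eq_iff)
  then show "\<exists>k::int. z = w + (of_int k, 0)" ..
qed (auto simp: annulus_of_def circle_of_eq_iff)

lemma continuous_on_circle_of: "continuous_on UNIV circle_of"
  by (subst continuous_on_open_vimage) (simp_all add: open_circle_def)

lemma continuous_on_annulus_of: "continuous_on UNIV annulus_of"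
  unfolding annulus_of_def[abs_def]
  by (intro continuous_intros continuous_on_compose2[OF continuous_on_circle_of]) auto

lemma open_circle_of_image:
  assumes "open A"
  shows "open (circle_of ` A)"
proof -
  have "circle_of -` circle_of ` A = (\<Union>k\<in>\<int>. (+) k ` A)"
  proof (intro equalityI subsetI)
    fix x assume "x \<in> circle_of -` circle_of ` A"
    then obtain y where "y \<in> A" "x - y \<in> \<int>" by (auto simp: circle_of_eq_iff)
    moreover have "x = (x - y) + y" by simp
    ultimately show "x \<in> (\<Union>k\<in>\<int>. (+) k ` A)" by blast
  next
    fix x assume "x \<in> (\<Union>k\<in>\<int>. (+) k ` A)"
    then obtain k y where "k \<in> \<int>" "y \<in> A" "x = k + y" by blast
    then have "circle_of x = circle_of y" by (simp add: circle_of_eq_iff)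
    then show "x \<in> circle_of -` circle_of ` A" using \<open>y \<in> A\<close> by simp
  qed
  moreover have "open (\<Union>k\<in>\<int>. (+) k ` A)"
    using assms by (intro open_UN ballI open_translation)
  ultimately show ?thesis by (simp add: open_circle_def)
qed

lemma open_annulus_of_image:
  assumes "open U"
  shows "open (annulus_of ` U)"
proof (rule open_prod_intro)
  fix p assume "p \<in> annulus_of ` U"
  then obtain z where z: "z \<in> U" "p = annulus_of z" by blast
  obtain A B where AB: "open A" "open B" "z \<in> A \<times> B" "A \<times> B \<subseteq> U"
    using assms z(1) by (rule open_prod_elim)
  have "circle_of ` A \<times> B \<subseteq> annulus_of ` (A \<times> B)"
  proof
    fix q assume "q \<in> circle_of ` A \<times> B"
    then obtain x where "x \<in> A" "snd q \<in> B" "fst q = circle_of x" by (auto simp: mem_Times_iff)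
    then have "q = annulus_of (x, snd q)" "(x, snd q) \<in> A \<times> B"
      by (simp_all add: annulus_of_def prod_eq_iff)
    then show "q \<in> annulus_of ` (A \<times> B)" by blast
  qed
  then have "circle_of ` A \<times> B \<subseteq> annulus_of ` U" using AB(4) by blast
  moreover have "p \<in> circle_of ` A \<times> B" using z(2) AB(3) by (auto simp: annulus_of_def)
  ultimately show "\<exists>A B. open A \<and> open B \<and> p \<in> A \<times> B \<and> A \<times> B \<subseteq> annulus_of ` U"
    using open_circle_of_image[OF AB(1)] AB(2) by blast
qed

text \<open>
  The embedding \<open>t \<mapsto> exp (2 \<pi> i t)\<close> of the circle into the complex plane; through it, lifting
  becomes a matter of continuous logarithms.
\<close>

lift_definition circle_exp :: "circle \<Rightarrow> complex" is "\<lambda>x. cis (2 * pi * x)"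
proof -
  fix x y :: real assume "x - y \<in> \<int>"
  then obtain k :: int where "x = y + of_int k"
    unfolding Ints_def by (metis (no_types, lifting) add.commute diff_add_cancel imageE)
  then have "2 * pi * x = 2 * pi * y + 2 * pi * of_int k" by (simp add: algebra_simps)
  then show "cis (2 * pi * x) = cis (2 * pi * y)"
    by (simp add: complex_eq_iff) (metis sin_cos_eq_iff mult.commute mult.assoc)
qed

lemma circle_exp_inject: "circle_exp s = circle_exp t \<longleftrightarrow> s = t"
proof -
  obtain x y where xy: "s = circle_of x" "t = circle_of y" using surj_circle_of by metis
  have "x - y \<in> \<int>" if "cis (2 * pi * x) = cis (2 * pi * y)"
  proof -
    have "sin (2 * pi * x) = sin (2 * pi * y) \<and> cos (2 * pi * x) = cos (2 * pi * y)"
      using that by (simp add: complex_eq_iff)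
    then obtain k :: int where "2 * pi * x = 2 * pi * y + 2 * pi * k"
      unfolding sin_cos_eq_iff by blast
    then have "2 * pi * (x - y) = 2 * pi * k" by (simp add: algebra_simps)
    then have "x - y = k" by simp
    then show ?thesis by simp
  qed
  then have "s = t" if "circle_exp s = circle_exp t"
    using that by (simp add: xy circle_exp.abs_eq circle_of_eq_iff)
  then show ?thesis by blast
qed

lemma continuous_on_circle_exp: "continuous_on UNIV circle_exp"
proof (subst continuous_on_open_vimage, simp, intro allI impI)
  fix V :: "complex set" assume "open V"
  moreover have "continuous_on UNIV (\<lambda>x. cis (2 * pi * x))" by (intro continuous_intros)
  ultimately have "open ((\<lambda>x. cis (2 * pi * x)) -` V)"
    using continuous_on_open_vimage[of UNIV "\<lambda>x. cis (2 * pi * x)"] by simp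
  then show "open (circle_exp -` V \<inter> UNIV)"
    by (simp add: open_circle_def vimage_def circle_exp.abs_eq)
qed

lemma norm_circle_exp: "norm (circle_exp t) = 1"
  by (transfer) simp

lemma continuous_lift_exists:
  assumes h: "continuous_on UNIV h"
  obtains H where "is_lift H h" "continuous_on UNIV H"
proof -
  have cont: "continuous_on UNIV (\<lambda>z. h (annulus_of z))"
    by (rule continuous_on_compose2[OF h continuous_on_annulus_of]) simp
  let ?f = "\<lambda>z. circle_exp (fst (h (annulus_of z)))"
  have contf: "continuous_on UNIV ?f"
    by (rule continuous_on_compose2[OF continuous_on_circle_exp])
      (rule continuous_on_fst[OF cont], rule subset_UNIV)
  have nz: "?f z \<noteq> 0" for z
  proof
    assume "?f z = 0"
    then have "norm (?f z) = 0" by simp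
    then show False unfolding norm_circle_exp by simp
  qed
  obtain g where g: "continuous_on UNIV g" "\<And>z. ?f z = exp (g z)"
    by (rule continuous_logarithm_on_contractible
        [OF contf convex_imp_contractible[OF convex_UNIV] nz]) blast
  define H where "H z = (Im (g z) / (2 * pi), snd (h (annulus_of z)))" for z
  have "annulus_of (H z) = h (annulus_of z)" for z
  proof -
    have "exp (Re (g z)) = 1" using g(2)[of z] norm_circle_exp norm_exp_eq_Re by metis
    then have "exp (g z) = cis (Im (g z))" by (simp add: exp_eq_polar)
    also have "\<dots> = circle_exp (circle_of (Im (g z) / (2 * pi)))" by (simp add: circle_exp.abs_eq)
    finally have "circle_of (Im (g z) / (2 * pi)) = fst (h (annulus_of z))"
      using g(2)[of z] circle_exp_inject by metis
    then show ?thesis by (simp add: annulus_of_def H_def)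
  qed
  moreover have "continuous_on UNIV H" unfolding H_def
    by (intro continuous_intros cont g(1)) auto
  ultimately show ?thesis using that unfolding is_lift_def by blast
qed

text \<open>
  A connected set close to the integers cannot cross a half-integer. This selects a single
  integer translation, both between two lifts of a map and between nearby lifts of nearby maps.
\<close>

lemma connected_near_integers:
  fixes A :: "real set"
  assumes "connected A" "e \<le> 1 / 4" "\<And>x. x \<in> A \<Longrightarrow> \<exists>k::int. \<bar>x - k\<bar> < e"
  shows "\<exists>k::int. \<forall>x\<in>A. \<bar>x - k\<bar> < e"
proof (cases "A = {}")
  case False
  then obtain x0 k0 where x0: "x0 \<in> A" "\<bar>x0 - real_of_int k0\<bar> < e" using assms(3) by blast
  have no: "x \<noteq> real_of_int m + 1 / 2" if "x \<in> A" for x m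
  proof
    assume x: "x = real_of_int m + 1 / 2"
    obtain k :: int where "\<bar>x - k\<bar> < e" using assms(3) \<open>x \<in> A\<close> by blast
    then have "\<bar>real_of_int (m - k) + 1 / 2\<bar> < 1 / 4" using assms(2) x by simp
    then have "real_of_int (m - k) < real_of_int 0" "real_of_int (- 1) < real_of_int (m - k)"
      unfolding abs_less_iff by simp_all
    then have "m - k < 0" "- 1 < m - k" unfolding of_int_less_iff .
    then show False by linarith
  qed
  have "\<bar>x - k0\<bar> < e" if x: "x \<in> A" for x
  proof -
    obtain k :: int where k: "\<bar>x - k\<bar> < e" using assms(3) x by blast
    consider "k0 + 1 \<le> k" | "k + 1 \<le> k0" | "k = k0" by linarith
    then show ?thesis
    proof cases
      case 1
      then have "real_of_int k0 + 1 \<le> real_of_int k" by linarith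
      then have "x0 \<le> real_of_int k0 + 1 / 2" "real_of_int k0 + 1 / 2 \<le> x"
        using x0 k assms(2) by linarith+
      then show ?thesis using connectedD_interval[OF assms(1) x0(1) x] no by blast
    next
      case 2
      then have "real_of_int k + 1 \<le> real_of_int k0" by linarith
      then have "x \<le> real_of_int k + 1 / 2" "real_of_int k + 1 / 2 \<le> x0"
        using x0 k assms(2) by linarith+
      then show ?thesis using connectedD_interval[OF assms(1) x x0(1)] no by blast
    qed (use k in simp)
  qed
  then show ?thesis by blast
qed simp

lemma lift_of_id_is_translation:
  assumes "continuous_on UNIV T" "\<And>z. annulus_of (T z) = annulus_of z"
  shows "\<exists>k::int. \<forall>z. T z = z + (of_int k, 0)"
proof -
  let ?u = "\<lambda>z. fst (T z) - fst z"
  have int: "\<exists>k::int. T z = z + (of_int k, 0)" for z using assms(2) annulus_of_eq_iff by blast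
  have "connected (range ?u)"
    by (intro connected_continuous_image continuous_intros assms(1) convex_connected convex_UNIV)
  moreover have "\<exists>k::int. \<bar>x - k\<bar> < 1 / 4" if "x \<in> range ?u" for x
  proof -
    obtain z where "x = ?u z" using \<open>x \<in> range ?u\<close> by blast
    moreover obtain k :: int where "T z = z + (of_int k, 0)" using int by blast
    ultimately have "\<bar>x - k\<bar> < 1 / 4" by simp
    then show ?thesis by blast
  qed
  ultimately obtain k :: int where k: "\<forall>x\<in>range ?u. \<bar>x - k\<bar> < 1 / 4"
    using connected_near_integers[of "range ?u" "1 / 4"] by auto
  have "T z = z + (of_int k, 0)" for z
  proof -
    obtain l :: int where l: "T z = z + (of_int l, 0)" using int by blast
    have "\<bar>?u z - k\<bar> < 1 / 4" using k by blast
    then have "\<bar>real_of_int (l - k)\<bar> < 1 / 4" using l by simp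
    then have "l = k" by linarith
    then show ?thesis using l by simp
  qed
  then show ?thesis by blast
qed

text \<open>
  The two compositions of \<open>H\<close> and \<open>K\<close> lift the identity, so they are integer translations; one
  translation then corrects \<open>K\<close> to a two-sided inverse of \<open>H\<close>.
\<close>

lemma lifts_of_inverse_maps:
  assumes H: "is_lift H h" "continuous_on UNIV H" and K: "is_lift K k" "continuous_on UNIV K"
    and inv: "\<And>p. k (h p) = p" "\<And>p. h (k p) = p"
  shows "\<exists>m::int. (\<forall>z. K (H z) - (of_int m, 0) = z) \<and> (\<forall>z. H (K z - (of_int m, 0)) = z)"
proof -
  have "continuous_on UNIV (\<lambda>z. K (H z))" "continuous_on UNIV (\<lambda>z. H (K z))"
    using continuous_on_compose2[OF K(2) H(2)] continuous_on_compose2[OF H(2) K(2)] by auto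
  moreover have "annulus_of (K (H z)) = annulus_of z" "annulus_of (H (K z)) = annulus_of z" for z
    using H(1) K(1) inv by (simp_all add: is_lift_def del: split_paired_All)
  ultimately obtain m n :: int where m: "\<forall>z. K (H z) = z + (of_int m, 0)"
    and n: "\<forall>z. H (K z) = z + (of_int n, 0)"
    using lift_of_id_is_translation by meson
  have KH: "K (H z) - (of_int m, 0) = z" for z using m[rule_format, of z] by simp
  have "H (K z - (of_int m, 0)) = z" for z
  proof -
    have "z = H (K (z - (of_int n, 0)))" using n[rule_format, of "z - (of_int n, 0)"] by simp
    then show ?thesis using KH by metis
  qed
  then show ?thesis using KH by blast
qed

lemma smooth_differentiable: "smooth H \<Longrightarrow> H differentiable (at z)"
  unfolding smooth_def by (drule spec[of _ "Suc 0"]) simp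

lemma differentiable_imp_continuous_UNIV:
  "(\<And>z. H differentiable (at z)) \<Longrightarrow> continuous_on UNIV H"
  by (simp add: continuous_at_imp_continuous_on differentiable_imp_continuous_within)

lemma symplectic_diffeomorphism_lift:
  assumes "symplectic_diffeomorphism h"
  obtains H where "is_lift H h" "plane_symplectomorphism H"
proof -
  obtain H where bij: "bij h" and H: "is_lift H h" "smooth H"
    and form: "\<And>z u v. symplectic_form (frechet_derivative H (at z) u) (frechet_derivative H (at z) v)
                = symplectic_form u v"
    using assms unfolding symplectic_diffeomorphism_def by blast
  obtain K where K: "is_lift K (inv h)" "smooth K"
    using assms unfolding symplectic_diffeomorphism_def smooth_map_def by blast
  note dH = smooth_differentiable[OF H(2)] and dK = smooth_differentiable[OF K(2)]
  obtain m :: int where m: "\<And>z. K (H z) - (of_int m, 0) = z" "\<And>z. H (K z - (of_int m, 0)) = z"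
    using lifts_of_inverse_maps[OF H(1) differentiable_imp_continuous_UNIV[OF dH]
        K(1) differentiable_imp_continuous_UNIV[OF dK]] bij
    by (metis bij_inv_eq_iff)
  have "bij H" using m by (metis bijI')
  moreover have "inv H = (\<lambda>z. K z - (of_int m, 0))" using m by (intro inv_equality)
  moreover have "(\<lambda>z. K z - (of_int m, 0)) differentiable (at z)" for z using dK by simp
  moreover have "(H has_derivative frechet_derivative H (at z)) (at z)" for z
    using dH frechet_derivative_works by blast
  ultimately have "plane_symplectomorphism H"
    unfolding plane_symplectomorphism_def using form by metis
  then show ?thesis using that H(1) by blast
qed

lemma plane_symplectomorphism_translation: "plane_symplectomorphism (\<lambda>z. z + c)"
proof -
  have "inv (\<lambda>z. z + c) = (\<lambda>z. z - c)" by (intro inv_equality) auto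
  moreover have "((\<lambda>z. z + c) has_derivative (\<lambda>u. u)) (at z)" for z
    by (auto intro!: derivative_eq_intros)
  moreover have "(\<lambda>z. z - c) differentiable (at z)" for z by simp
  moreover have "bij (\<lambda>z. z + c)" by (rule o_bij[of "\<lambda>z. z - c"]) auto
  ultimately show ?thesis unfolding plane_symplectomorphism_def by metis
qed

lemma compact_open_convergence:
  assumes "limitin compact_open_topology h f sequentially" "compact K" "open U" "f ` K \<subseteq> U"
    and "continuous_on UNIV f"
  shows "\<forall>\<^sub>F n in sequentially. h n ` K \<subseteq> U"
proof -
  let ?V = "{h. continuous_on UNIV h \<and> h ` K \<subseteq> U}"
  have "openin compact_open_topology ?V"
    unfolding compact_open_topology_def using assms(2,3) by (intro topology_generated_by_Basis) blast
  moreover have "f \<in> ?V" using assms by simp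
  ultimately have "\<forall>\<^sub>F n in sequentially. h n \<in> ?V"
    using assms(1) unfolding limitin_def by blast
  then show ?thesis by (rule eventually_mono) simp
qed

text \<open>
  On small discs, convergence in the compact-open topology says that some integer translate of a
  lift of \<open>h n\<close> is close to \<open>F\<close> at each point. Finitely many discs cover a given ball, and since the
  ball is connected the same translation works at all its points.
\<close>

lemma symplectic_homeomorphism_lift:
  assumes f: "symplectic_homeomorphism f" and F: "is_lift F f" "continuous_on UNIV F"
  shows "C0_symplectic F"
  unfolding C0_symplectic_def
proof (intro conjI allI impI)
  obtain g h where g: "homeomorphism UNIV UNIV f g"
    and h: "\<And>n. symplectic_diffeomorphism (h n)" "limitin compact_open_topology h f sequentially"
    using f unfolding symplectic_homeomorphism_def by blast
  have cont: "continuous_on UNIV f" "continuous_on UNIV g" using g by (auto simp: homeomorphism_def)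
  obtain G where G: "is_lift G g" "continuous_on UNIV G" using continuous_lift_exists[OF cont(2)] .
  obtain m :: int where "\<And>z. G (F z) - (of_int m, 0) = z" "\<And>z. F (G z - (of_int m, 0)) = z"
    using lifts_of_inverse_maps[OF F G] g unfolding homeomorphism_def by (metis UNIV_I)
  then have "homeomorphism UNIV UNIV F (\<lambda>z. G z - (of_int m, 0))"
    using F(2) G(2) by (intro homeomorphismI continuous_intros) auto
  then show "\<exists>G. homeomorphism UNIV UNIV F G" by blast

  fix R \<epsilon> :: real assume "\<epsilon> > 0"
  define e where "e = min (\<epsilon> / 2) (1 / 4)"
  have e: "0 < e" "e \<le> 1 / 4" "2 * e \<le> \<epsilon>" using \<open>\<epsilon> > 0\<close> by (auto simp: e_def min_def)
  let ?K = "cball (0 :: plane) R"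
  have "\<exists>\<delta>>0. \<forall>z\<in>cball a \<delta>. dist (F z) (F a) < e / 2" for a
  proof -
    have "isCont F a" using F(2) by (simp add: continuous_on_eq_continuous_at del: split_paired_All)
    then obtain d where "d > 0" "\<forall>z. dist z a < d \<longrightarrow> dist (F z) (F a) < e / 2"
      using e(1) unfolding continuous_at_eps_delta by (metis half_gt_zero)
    then show ?thesis by (intro exI[of _ "d / 2"]) (auto simp: dist_commute)
  qed
  then obtain \<delta> where \<delta>: "\<And>a. \<delta> a > 0"
    "\<And>a z. z \<in> cball a (\<delta> a) \<Longrightarrow> dist (F z) (F a) < e / 2" by metis
  obtain A where A: "finite A" "?K \<subseteq> (\<Union>a\<in>A. ball a (\<delta> a))"
  proof (rule compactE_image[OF compact_cball, of UNIV "\<lambda>a. ball a (\<delta> a)" 0 R])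
    show "?K \<subseteq> (\<Union>a\<in>UNIV. ball a (\<delta> a))" using \<delta>(1) centre_in_ball by blast
  qed auto
  have "\<forall>\<^sub>F n in sequentially. h n ` annulus_of ` cball a (\<delta> a) \<subseteq> annulus_of ` ball (F a) (e / 2)" for a
  proof (rule compact_open_convergence[OF h(2)])
    show "compact (annulus_of ` cball a (\<delta> a))"
      by (intro compact_continuous_image continuous_on_subset[OF continuous_on_annulus_of]) auto
    show "f ` annulus_of ` cball a (\<delta> a) \<subseteq> annulus_of ` ball (F a) (e / 2)"
    proof
      fix p assume "p \<in> f ` annulus_of ` cball a (\<delta> a)"
      then obtain z where z: "z \<in> cball a (\<delta> a)" "p = f (annulus_of z)" by blast
      have "F z \<in> ball (F a) (e / 2)" using z(1) \<delta>(2) by (metis dist_commute mem_ball)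
      moreover have "f (annulus_of z) = annulus_of (F z)" using F(1) unfolding is_lift_def by metis
      ultimately show "p \<in> annulus_of ` ball (F a) (e / 2)" using z(2) by simp
    qed
  qed (rule open_annulus_of_image[OF open_ball], rule cont(1))
  then have "\<forall>\<^sub>F n in sequentially. \<forall>a\<in>A. h n ` annulus_of ` cball a (\<delta> a) \<subseteq> annulus_of ` ball (F a) (e / 2)"
    using A(1) by (intro eventually_ball_finite ballI)
  then obtain n where n: "\<And>a. a \<in> A \<Longrightarrow> h n ` annulus_of ` cball a (\<delta> a) \<subseteq> annulus_of ` ball (F a) (e / 2)"
    using eventually_happens'[OF sequentially_bot] by (metis (no_types, lifting))
  obtain H where H: "is_lift H (h n)" "plane_symplectomorphism H"
    using symplectic_diffeomorphism_lift[OF h(1)] .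
  have near: "\<exists>k::int. dist (H z - (of_int k, 0)) (F z) < e" if z: "z \<in> ?K" for z
  proof -
    obtain a where a: "a \<in> A" "z \<in> ball a (\<delta> a)" using A(2) z by blast
    then have za: "z \<in> cball a (\<delta> a)" using ball_subset_cball by blast
    have "annulus_of (H z) = h n (annulus_of z)" using H(1) unfolding is_lift_def by metis
    then have "annulus_of (H z) \<in> annulus_of ` ball (F a) (e / 2)" using n[OF a(1)] za by auto
    then obtain w where w: "w \<in> ball (F a) (e / 2)" "annulus_of (H z) = annulus_of w" by blast
    then obtain k :: int where "H z = w + (of_int k, 0)" using annulus_of_eq_iff by blast
    then have "H z - (of_int k, 0) = w" by simp
    moreover have "dist w (F z) < e"
      using dist_triangle_half_r[of "F a" w e "F z"] w(1) \<delta>(2)[OF za] by (simp add: dist_commute)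
    ultimately show ?thesis by metis
  qed
  let ?u = "\<lambda>z. fst (H z) - fst (F z)"
  have "connected (?u ` ?K)"
    by (intro connected_continuous_image continuous_intros convex_connected
        continuous_on_subset[OF F(2)] plane_symplectomorphism_continuous[OF H(2)]) auto
  moreover have "\<exists>k::int. \<bar>x - k\<bar> < e" if "x \<in> ?u ` ?K" for x
  proof -
    obtain z where z: "z \<in> ?K" "x = ?u z" using \<open>x \<in> ?u ` ?K\<close> by blast
    obtain k :: int where k: "dist (H z - (of_int k, 0)) (F z) < e" using near[OF z(1)] by blast
    have "\<bar>x - k\<bar> = dist (fst (H z - (of_int k, 0))) (fst (F z))" by (simp add: z(2) dist_real_def)
    then show ?thesis using dist_fst_le[of "H z - (of_int k, 0)" "F z"] k by (metis order_le_less_trans)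
  qed
  ultimately obtain k :: int where k: "\<And>x. x \<in> ?u ` ?K \<Longrightarrow> \<bar>x - k\<bar> < e"
    using connected_near_integers[OF _ e(2)] by blast
  let ?H = "(\<lambda>z. z + (- of_int k, 0)) \<circ> H"
  have "dist (?H z) (F z) < \<epsilon>" if z: "z \<in> ?K" for z
  proof -
    obtain j :: int where j: "dist (H z - (of_int j, 0)) (F z) < e" using near[OF z] by blast
    have "\<bar>fst (?H z - F z)\<bar> < e" using k[of "?u z"] z by (simp add: algebra_simps)
    moreover have "\<bar>snd (?H z - F z)\<bar> < e"
      using dist_snd_le[of "H z - (of_int j, 0)" "F z"] j by (simp add: dist_real_def)
    moreover have "dist (?H z) (F z) \<le> \<bar>fst (?H z - F z)\<bar> + \<bar>snd (?H z - F z)\<bar>"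
      unfolding dist_norm using norm_Pair_le[of "fst (?H z - F z)" "snd (?H z - F z)"]
      by (simp only: prod.collapse real_norm_def)
    ultimately show ?thesis using e(3) by linarith
  qed
  moreover have "plane_symplectomorphism ?H"
    by (intro plane_symplectomorphism_comp plane_symplectomorphism_translation H(2))
  ultimately show "\<exists>H. plane_symplectomorphism H \<and> (\<forall>z\<in>?K. dist (H z) (F z) < \<epsilon>)" by blast
qed

section \<open>Arnol'd-Liouville coordinates\<close>

theorem proposition1p2:
  fixes f \<Phi> :: "annulus \<Rightarrow> annulus" and F :: "annulus set set"
  assumes "symplectic_homeomorphism f"
    and "C0_foliation F"
    and "preserves_leaves f F"
    and "symplectically_straightens \<Phi> F"
  shows "C0_Arnold_Liouville_coordinates \<Phi> f"
proof -
  have \<Phi>: "symplectic_homeomorphism \<Phi>" and F: "F = (\<lambda>L. \<Phi> ` L) ` standard_foliation"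
    using assms(4) unfolding symplectically_straightens_def by auto
  have cont: "continuous_on UNIV f" "continuous_on UNIV \<Phi>"
    using assms(1) \<Phi> unfolding symplectic_homeomorphism_def homeomorphism_def by auto
  have bij: "bij \<Phi>"
    using \<Phi> unfolding symplectic_homeomorphism_def homeomorphism_def by (metis UNIV_I bijI')
  have inv: "inv \<Phi> (\<Phi> p) = p" "\<Phi> (inv \<Phi> p) = p" for p
    using bij by (simp_all add: bij_is_inj bij_is_surj surj_f_inv_f)
  define g where "g = inv \<Phi> \<circ> f \<circ> \<Phi>"
  have leaves: "g ` L = L" if L: "L \<in> standard_foliation" for L
  proof -
    have "f ` \<Phi> ` L = \<Phi> ` L" using assms(3) L unfolding preserves_leaves_def F by blast
    then have "inv \<Phi> ` f ` \<Phi> ` L = inv \<Phi> ` \<Phi> ` L" by simp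
    then show ?thesis by (simp add: g_def image_comp inv o_def)
  qed
  have snd_g: "snd (g p) = snd p" for p
  proof -
    have "UNIV \<times> {snd p} \<in> standard_foliation" unfolding standard_foliation_def by blast
    moreover have "p \<in> UNIV \<times> {snd p}" by (cases p) simp
    ultimately have "g p \<in> UNIV \<times> {snd p}" using leaves imageI by metis
    then show ?thesis by (simp add: mem_Times_iff)
  qed
  obtain P where P: "is_lift P \<Phi>" "continuous_on UNIV P" using continuous_lift_exists[OF cont(2)] .
  obtain Q where Q: "is_lift Q f" "continuous_on UNIV Q" using continuous_lift_exists[OF cont(1)] .
  have symP: "C0_symplectic P" by (rule symplectic_homeomorphism_lift[OF \<Phi> P])
  have symQ: "C0_symplectic Q" by (rule symplectic_homeomorphism_lift[OF assms(1) Q])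
  define G where "G = inv P \<circ> (Q \<circ> P)"
  have symG: "C0_symplectic G" unfolding G_def
    by (intro C0_symplectic_comp C0_symplectic_inv symP symQ)
  have lift: "annulus_of (G z) = g (annulus_of z)" for z
  proof -
    have "P (G z) = Q (P z)"
      using C0_symplecticD(1)[OF symP] by (simp add: G_def bij_is_surj surj_f_inv_f)
    then have "\<Phi> (annulus_of (G z)) = f (\<Phi> (annulus_of z))"
      using P(1) Q(1) unfolding is_lift_def by metis
    then show ?thesis unfolding g_def comp_apply by (metis inv(1))
  qed
  have "snd (G z) = snd z" for z
    using arg_cong[OF lift[of z], of snd] snd_g by (simp add: annulus_of_def)
  note trans = C0_symplectic_fibre_translation[OF symG this]
  define \<rho> where "\<rho> c = fst (G (0, c))" for c
  have "continuous_on UNIV \<rho>" unfolding \<rho>_def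
    by (intro continuous_intros continuous_on_compose2[OF C0_symplecticD(2)[OF symG, of UNIV]]) auto
  moreover have "\<forall>x c. g (x, c) = (x + circle_of (\<rho> c), c)"
  proof (intro allI)
    fix x c
    obtain t where t: "x = circle_of t" using surj_circle_of by blast
    have "g (x, c) = annulus_of (G (t, c))" using lift by (simp add: t annulus_of_def)
    also have "\<dots> = annulus_of (t + \<rho> c, c)" unfolding trans[of t] \<rho>_def ..
    finally show "g (x, c) = (x + circle_of (\<rho> c), c)" by (simp add: annulus_of_def t plus_circle.abs_eq)
  qed
  ultimately have "\<exists>\<rho> :: real \<Rightarrow> real. continuous_on UNIV \<rho> \<and> (\<forall>x c. g (x, c) = (x + circle_of (\<rho> c), c))"
    by (intro exI[of _ \<rho>] conjI)
  moreover have "preserves_leaves g standard_foliation"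
    unfolding preserves_leaves_def by (intro ballI leaves)
  ultimately show ?thesis
    unfolding C0_Arnold_Liouville_coordinates_def g_def[symmetric] by (intro conjI \<Phi>)
qed

end
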